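(* Let $K$ be a pure cubic field and let $L$ be any cubic number field. If the shape of $L$ equals the shape of $K$, then $L\cong K$. In particular, the shape is a complete invariant for pure cubic fields within the family of all cubic fields: distinct (non-isomorphic) pure cubic fields have distinct shapes, and no non-pure cubic field has the shape of a pure cubic field.
   Context: A pure cubic field is a field $\mathbf{Q}(m^{1/3})$ with $m$ a positive integer that is not a cube. Shape: for a cubic number field $K$, let $K\otimes_{\mathbf{Q}}\mathbf{R}$ carry the positive definite inner product whose quadratic form is $x\mapsto\sum_{\sigma\in\mathrm{Hom}(K,\mathbf{C})}|\sigma(x)|^2$. Let $\mathcal{O}_K^\perp$ be the image of $\mathcal{O}_K$ under orthogonal projection onto the orthogonal complement of $1$; it is a rank $2$ lattice. The shape of $K$ is the equivalence class of $\mathcal{O}_K^\perp$ up to scaling by positive reals, rotations and reflections; equivalently, the $\mathrm{GL}_2(\mathbf{Z})$-orbit in the upper half-plane $\mathfrak{H}$ of the point $x+iy$ with $x=B_{01}/B_{00}$, $y=\sqrt{B_{11}/B_{00}-x^2}$, where $B$ is the Gram matrix of any basis of $\mathcal{O}_K^\perp$ and $\mathrm{GL}_2(\mathbf{Z})$ acts by fractional linear transformations together with $\begin{pmatrix}0&1\\1&0\end{pmatrix}\cdot z=1/\bar z$. *)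

theory Defs
  imports "HOL-Analysis.Analysis" "HOL-Computational_Algebra.Computational_Algebra"
begin

(* A number field is a type of class field_char_0 that has finite dimension over the rationals.
   Fields are passed to predicates as TYPE('k). *)

lemma vector_space_of_rat:
  "vector_space (\<lambda>(q::rat) (x::'k::field_char_0). of_rat q * x)"
  by unfold_locales (simp_all add: algebra_simps of_rat_add of_rat_mult)

definition cubic_field :: "'k::field_char_0 itself \<Rightarrow> bool" where
  "cubic_field _ \<longleftrightarrow>
     vector_space.dim (\<lambda>(q::rat) (x::'k). of_rat q * x) UNIV = 3"

definition field_hom :: "('a::field \<Rightarrow> 'b::field) \<Rightarrow> bool" where
  "field_hom \<phi> \<longleftrightarrow>
     \<phi> 1 = 1 \<and> (\<forall>x y. \<phi> (x + y) = \<phi> x + \<phi> y) \<and> (\<forall>x y. \<phi> (x * y) = \<phi> x * \<phi> y)"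

definition isomorphic_fields :: "'a::field itself \<Rightarrow> 'b::field itself \<Rightarrow> bool" where
  "isomorphic_fields _ _ \<longleftrightarrow> (\<exists>\<phi> :: 'a \<Rightarrow> 'b. field_hom \<phi> \<and> bij \<phi>)"

definition is_subfield :: "'a::field set \<Rightarrow> bool" where
  "is_subfield F \<longleftrightarrow>
     1 \<in> F \<and> (\<forall>x\<in>F. \<forall>y\<in>F. x - y \<in> F \<and> x * y \<in> F) \<and> (\<forall>x\<in>F. inverse x \<in> F)"

(* In characteristic 0, the field obtained by adjoining S to the rationals. *)
definition generated_subfield :: "'a::field_char_0 set \<Rightarrow> 'a set" where
  "generated_subfield S = \<Inter>{F. is_subfield F \<and> S \<subseteq> F}"

(* Up to isomorphism, the subfield of the reals generated by the real cube root of m. *)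
definition pure_cubic_field :: "'k::field_char_0 itself \<Rightarrow> bool" where
  "pure_cubic_field _ \<longleftrightarrow>
     (\<exists>m::nat. m > 0 \<and> (\<nexists>n::nat. n ^ 3 = m) \<and>
        (\<exists>\<phi> :: 'k \<Rightarrow> real. field_hom \<phi> \<and> range \<phi> = generated_subfield {root 3 (real m)}))"

definition complex_embeddings :: "('k::field_char_0 \<Rightarrow> complex) set" where
  "complex_embeddings = {\<sigma>. field_hom \<sigma>}"

(* The tensor product of K with the reals is represented by its image in the product of copies
   of the complex numbers indexed by Hom(K,C), under the map that sends the tensor of x and c
   to the family (c * \<sigma> x); this map is injective for a number field K.
   The product is encoded by the functions that vanish off the set complex_embeddings, and
   minkowski_embedding x corresponds to the tensor of x and 1. *)

definition minkowski_embedding :: "'k::field_char_0 \<Rightarrow> ('k \<Rightarrow> complex) \<Rightarrow> complex" where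
  "minkowski_embedding x = (\<lambda>\<sigma>. if \<sigma> \<in> complex_embeddings then \<sigma> x else 0)"

definition minkowski_space :: "(('k::field_char_0 \<Rightarrow> complex) \<Rightarrow> complex) set" where
  "minkowski_space =
     {v. \<exists>(S::'k set) (c::'k \<Rightarrow> real). finite S \<and>
           v = (\<lambda>\<sigma>. \<Sum>x\<in>S. of_real (c x) * minkowski_embedding x \<sigma>)}"

(* The Hermitian sum is already real on minkowski_space, because the families there are
   compatible with complex conjugation of embeddings. *)
definition minkowski_inner ::
    "(('k::field_char_0 \<Rightarrow> complex) \<Rightarrow> complex) \<Rightarrow> (('k \<Rightarrow> complex) \<Rightarrow> complex) \<Rightarrow> real" where
  "minkowski_inner u v = Re (\<Sum>\<sigma>\<in>complex_embeddings. u \<sigma> * cnj (v \<sigma>))"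

definition one_complement :: "(('k::field_char_0 \<Rightarrow> complex) \<Rightarrow> complex) set" where
  "one_complement = {v \<in> minkowski_space. minkowski_inner v (minkowski_embedding 1) = 0}"

definition proj_one_complement ::
    "(('k::field_char_0 \<Rightarrow> complex) \<Rightarrow> complex) \<Rightarrow> ('k \<Rightarrow> complex) \<Rightarrow> complex" where
  "proj_one_complement v =
     (let e = minkowski_embedding 1
      in (\<lambda>\<sigma>. v \<sigma> - of_real (minkowski_inner v e / minkowski_inner e e) * e \<sigma>))"

definition ring_of_integers :: "'k::field_char_0 set" where
  "ring_of_integers = {x. algebraic_int x}"

definition integers_perp :: "(('k::field_char_0 \<Rightarrow> complex) \<Rightarrow> complex) set" where
  "integers_perp = (\<lambda>x. proj_one_complement (minkowski_embedding x)) ` ring_of_integers"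

(* Real-linear maps of one_complement onto the Euclidean plane that multiply all lengths by the
   same positive constant. *)
definition similitude ::
    "((('k::field_char_0 \<Rightarrow> complex) \<Rightarrow> complex) \<Rightarrow> real ^ 2) \<Rightarrow> bool" where
  "similitude f \<longleftrightarrow>
     f ` one_complement = UNIV \<and>
     (\<forall>u\<in>one_complement. \<forall>v\<in>one_complement. f (\<lambda>\<sigma>. u \<sigma> + v \<sigma>) = f u + f v) \<and>
     (\<forall>a::real. \<forall>v\<in>one_complement. f (\<lambda>\<sigma>. of_real a * v \<sigma>) = a *\<^sub>R f v) \<and>
     (\<exists>c>0. \<forall>v\<in>one_complement. norm (f v) = c * sqrt (minkowski_inner v v))"

(* The equivalence class of integers_perp up to scaling, rotations and reflections, as a set of
   lattices in the standard Euclidean plane: identifying one_complement isometrically with the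
   plane and then applying all scalings, rotations and reflections gives exactly the images
   under similitudes. *)
definition shape :: "'k::field_char_0 itself \<Rightarrow> (real ^ 2) set set" where
  "shape _ = {f ` (integers_perp :: (('k \<Rightarrow> complex) \<Rightarrow> complex) set) | f. similitude f}"

end

theory Submission
  imports Defs
begin

text \<open>
  Fix a real embedding of the cubic field \<open>L\<close> with image \<open>F\<close>. The squared length of the projection of
  every element of \<open>L\<close> lies in \<open>F\<close>: the two other roots of a defining cubic are \<open>u \<plusminus> w\<close> with
  \<open>u, w\<^sup>2 \<in> F\<close>, and the sum over the embeddings is symmetric in them. If \<open>K\<close> is the pure field of
  \<open>\<alpha> = root 3 m\<close>, then \<open>\<alpha>\<close> and \<open>\<alpha>\<^sup>2\<close> are integral and orthogonal to 1, with squared lengths \<open>3 * \<alpha>\<^sup>2\<close>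
  and \<open>3 * \<alpha> ^ 4\<close>. A similarity of the two lattices preserves the ratio \<open>\<alpha>\<^sup>2\<close> of these values, so
  \<open>\<alpha>\<^sup>2 \<in> F\<close>, hence \<open>\<alpha> = m / \<alpha>\<^sup>2 \<in> F\<close>, and \<open>F\<close> is the image of \<open>K\<close> because both are cubic. No integral
  basis is needed.
\<close>

section \<open>Field homomorphisms\<close>

context
  fixes h :: "'a::field_char_0 \<Rightarrow> 'b::field_char_0"
  assumes h: "field_hom h"
begin

lemma field_hom_one: "h 1 = 1"
  and field_hom_add: "h (x + y) = h x + h y"
  and field_hom_mult: "h (x * y) = h x * h y"
  using h by (auto simp: field_hom_def)

lemma field_hom_zero: "h 0 = 0"
  using field_hom_add[of 0 0] by simp

lemma field_hom_minus: "h (- x) = - h x"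
  using field_hom_add[of x "- x"] field_hom_zero by (simp add: eq_neg_iff_add_eq_0 add.commute)

lemma field_hom_diff: "h (x - y) = h x - h y"
  using field_hom_add[of x "- y"] by (simp add: field_hom_minus)

lemma field_hom_power: "h (x ^ n) = h x ^ n"
  by (induction n) (simp_all add: field_hom_one field_hom_mult)

lemma field_hom_inverse: "h (inverse x) = inverse (h x)"
proof (cases "x = 0")
  case False
  then have "h (inverse x) * h x = 1"
    by (simp add: field_hom_one flip: field_hom_mult)
  then show ?thesis
    by (metis inverse_unique mult.commute)
qed (simp add: field_hom_zero)

lemma field_hom_of_nat: "h (of_nat n) = of_nat n"
  by (induction n) (simp_all add: field_hom_zero field_hom_one field_hom_add)

lemma field_hom_of_int: "h (of_int n) = of_int n"
  by (cases n) (simp_all add: field_hom_of_nat field_hom_minus field_hom_diff field_hom_one)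

lemma field_hom_of_rat: "h (of_rat a) = of_rat a"
proof -
  obtain m n where "a = Rat.Fract m n" "n > 0"
    by (cases a) auto
  then show ?thesis
    by (simp add: of_rat_rat divide_inverse field_hom_mult field_hom_inverse field_hom_of_int)
qed

lemma field_hom_inj: "inj h"
proof (rule injI)
  fix x y assume "h x = h y"
  then have "h (x - y) * h (inverse (x - y)) = 0"
    by (simp add: field_hom_diff)
  then have "x - y = 0"
    using field_hom_one field_hom_mult by (metis right_inverse zero_neq_one)
  then show "x = y" by simp
qed

lemma is_subfield_range_field_hom: "is_subfield (range h)"
  unfolding is_subfield_def
  by (auto intro: rev_image_eqI[of 1] simp: field_hom_one
      simp flip: field_hom_diff field_hom_mult field_hom_inverse)

lemma algebraic_int_field_hom:
  assumes "algebraic_int x"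
  shows "algebraic_int (h x)"
proof -
  from assms obtain p :: "int poly" where p: "poly (map_poly of_int p) x = 0" "lead_coeff p = 1"
    by (auto simp: algebraic_int_altdef_ipoly)
  have "h (poly (map_poly of_int p) x) = poly (map_poly of_int p) (h x)"
    by (induction p)
       (simp_all add: map_poly_pCons field_hom_zero field_hom_add field_hom_mult field_hom_of_int)
  with p show ?thesis
    by (auto simp: algebraic_int_altdef_ipoly field_hom_zero)
qed

end

lemma field_hom_comp:
  assumes "field_hom f" "field_hom g"
  shows "field_hom (f \<circ> g)"
  using assms by (simp add: field_hom_def)

lemma field_hom_inv_into:
  assumes "field_hom (f :: 'b::field_char_0 \<Rightarrow> 'c::field_char_0)" "field_hom (g :: 'a::field_char_0 \<Rightarrow> 'c)"
    and "range g \<subseteq> range f"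
  shows "field_hom (inv f \<circ> g)"
proof -
  have inj: "inj f" by (rule field_hom_inj[OF assms(1)])
  have eq: "f (inv f (g x)) = g x" for x
    using assms(3) by (intro f_inv_into_f) auto
  have *: "inv f y = z" if "y = f z" for y z
    using that inj by simp
  show ?thesis
    unfolding field_hom_def
    by (auto simp: eq field_hom_one[OF assms(1)] field_hom_add[OF assms(1)] field_hom_mult[OF assms(1)]
        field_hom_one[OF assms(2)] field_hom_add[OF assms(2)] field_hom_mult[OF assms(2)] intro!: *)
qed

lemma field_hom_inv:
  fixes \<eta> :: "'a::field_char_0 \<Rightarrow> 'b::field_char_0"
  assumes "field_hom \<eta>" "bij \<eta>"
  shows "field_hom (inv \<eta>)"
  using field_hom_inv_into[of \<eta> id] assms bij_is_surj[OF assms(2)] by (simp add: field_hom_def)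

text \<open>Both fields are compared inside a common third field, later the reals:
  \<open>inv f \<circ> g\<close> goes up along one embedding and back down along the other.\<close>

lemma isomorphic_fieldsI_range:
  fixes f :: "'b::field_char_0 \<Rightarrow> 'c::field_char_0" and g :: "'a::field_char_0 \<Rightarrow> 'c"
  assumes "field_hom f" "field_hom g" "range g = range f"
  shows "isomorphic_fields TYPE('a) TYPE('b)"
proof -
  have "bij (inv f \<circ> g)"
  proof (rule bijI)
    have "inj_on (inv f) (range g)"
      unfolding assms(3) by (rule inj_on_inv_into) simp
    then show "inj (inv f \<circ> g)"
      by (rule comp_inj_on[OF field_hom_inj[OF assms(2)]])
    show "surj (inv f \<circ> g)"
      by (metis assms(3) image_comp inv_o_cancel[OF field_hom_inj[OF assms(1)]] surj_id)
  qed
  then show ?thesis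
    using field_hom_inv_into[of f g] assms unfolding isomorphic_fields_def by auto
qed

section \<open>Closure properties of subfields\<close>

lemma is_subfieldD:
  assumes "is_subfield F"
  shows "1 \<in> F" "0 \<in> F"
    "x \<in> F \<Longrightarrow> y \<in> F \<Longrightarrow> x - y \<in> F"
    "x \<in> F \<Longrightarrow> y \<in> F \<Longrightarrow> x + y \<in> F"
    "x \<in> F \<Longrightarrow> y \<in> F \<Longrightarrow> x * y \<in> F"
    "x \<in> F \<Longrightarrow> y \<in> F \<Longrightarrow> x / y \<in> F"
    "x \<in> F \<Longrightarrow> - x \<in> F"
    "x \<in> F \<Longrightarrow> x ^ n \<in> F"
proof -
  note F = assms[unfolded is_subfield_def]
  show 1: "1 \<in> F" using F by auto
  show 0: "0 \<in> F" using F 1 by (metis diff_self)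
  have minus: "- x \<in> F" if "x \<in> F" for x
    using F 0 that by (metis diff_0)
  show "x - y \<in> F" if "x \<in> F" "y \<in> F" using F that by auto
  show "x + y \<in> F" if "x \<in> F" "y \<in> F" using F that minus by (metis diff_minus_eq_add)
  show mult: "x * y \<in> F" if "x \<in> F" "y \<in> F" for x y using F that by auto
  show "x / y \<in> F" if "x \<in> F" "y \<in> F" using F that by (simp add: divide_inverse)
  show "- x \<in> F" if "x \<in> F" using minus that .
  show "x ^ n \<in> F" if "x \<in> F" by (induction n) (use 1 mult that in auto)
qed

lemma of_rat_in_subfield:
  fixes F :: "'a::field_char_0 set"
  assumes F: "is_subfield F"
  shows "of_rat a \<in> F"
proof -
  have nat: "of_nat n \<in> F" for n
    by (induction n) (auto intro: is_subfieldD[OF F])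
  have int: "of_int n \<in> F" for n
    by (cases n) (auto intro!: is_subfieldD[OF F] nat simp del: of_nat_Suc)
  obtain m n where "a = Rat.Fract m n" "n > 0"
    by (cases a) auto
  then show ?thesis
    by (auto simp: of_rat_rat intro!: is_subfieldD[OF F] int)
qed

lemma sum_in_subfield:
  assumes F: "is_subfield F"
  shows "(\<And>x. x \<in> A \<Longrightarrow> g x \<in> F) \<Longrightarrow> sum g A \<in> F"
  by (induction A rule: infinite_finite_induct) (auto intro: is_subfieldD[OF F])

section \<open>Cubic fields with a generator\<close>

text \<open>Records a rational power basis and the coefficients of the cubic equation of \<theta>.
  With coordinates at hand, every embedding becomes an explicit formula.\<close>

locale cubic_generator =
  fixes \<theta> :: "'k::field_char_0" and p q r :: rat
  assumes spanning: "\<exists>a b c. x = of_rat a + of_rat b * \<theta> + of_rat c * \<theta>\<^sup>2"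
    and indep: "of_rat a + of_rat b * \<theta> + of_rat c * \<theta>\<^sup>2 = 0 \<Longrightarrow> a = 0 \<and> b = 0 \<and> c = 0"
    and cube: "\<theta> ^ 3 = of_rat p + of_rat q * \<theta> + of_rat r * \<theta>\<^sup>2"

text \<open>Since 3 is prime, an irrational element lies in no proper subfield. The essential point
  is the independence of 1, \<theta>, \<open>\<theta>\<^sup>2\<close>; the dimension then gives
  spanning, and the cubic relation is the expansion of \<open>\<theta> ^ 3\<close>. An arbitrary
  irrational \<theta> is allowed so that a preimage of a real cube root can be taken later.\<close>

lemma cubic_field_generator:
  fixes \<theta> :: "'k::field_char_0"
  assumes cubic: "cubic_field TYPE('k)" and irrat: "\<theta> \<notin> range of_rat"
  shows "\<exists>p q r. cubic_generator \<theta> p q r"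
proof -
  interpret vector_space "\<lambda>(q::rat) (x::'k). of_rat q * x"
    by (rule vector_space_of_rat)
  obtain B where B: "independent B" "UNIV \<subseteq> span B" "card B = 3"
    using basis_exists[of UNIV] cubic unfolding cubic_field_def by metis
  then have fin: "finite B"
    by (metis card.infinite zero_neq_numeral)
  have card_le: "finite S \<and> card S \<le> 3" if "independent S" for S
    using independent_span_bound[OF fin that] B by auto
  have full: "x \<in> span S" if "independent S" "card S = 3" for x S
  proof (rule ccontr)
    assume x: "x \<notin> span S"
    then have "x \<notin> S" using span_base by blast
    with card_le[OF that(1)] that(2) have "card (insert x S) = 4" by simp
    with card_le[OF independent_insertI[OF x that(1)]] show False by simp
  qed
  have span1: "x \<in> span {1} \<longleftrightarrow> x \<in> range of_rat" for x
    by (auto simp: span_singleton)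
  have span2: "x \<in> span {\<theta>, 1} \<longleftrightarrow> (\<exists>a b. x = of_rat a + of_rat b * \<theta>)" for x
    unfolding span_breakdown_eq[of x \<theta>] span1 by (auto simp: image_iff diff_eq_eq)
  have span3: "x \<in> span {y, \<theta>, 1} \<longleftrightarrow> (\<exists>a b c. x = of_rat a + of_rat b * \<theta> + of_rat c * y)" for x y
    unfolding span_breakdown_eq[of x y] span2 by (auto simp: diff_eq_eq)
  have ind1: "independent {1}"
    by simp
  have ind2: "independent {\<theta>, 1}"
    by (rule independent_insertI[OF _ ind1]) (use irrat span1 in auto)
  have "card {\<theta>, 1} = 2"
    using irrat by (metis card_2_iff of_rat_1 rangeI)
  have ind3: "independent {y, \<theta>, 1} \<and> card {y, \<theta>, 1} = 3" if "y \<notin> span {\<theta>, 1}" for y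
  proof
    show "independent {y, \<theta>, 1}"
      using that ind2 by (rule independent_insertI)
    have "y \<notin> {\<theta>, 1}" using that span_base by blast
    with \<open>card {\<theta>, 1} = 2\<close> show "card {y, \<theta>, 1} = 3"
      by simp
  qed
  \<comment> \<open>Otherwise the span of 1 and \<open>\<theta>\<close> is a quadratic subfield. Then 1, \<open>\<theta>\<close>, \<open>y\<close> and \<open>\<theta> * y\<close> are
    independent for every \<open>y\<close> outside it, which is impossible in dimension 3.\<close>
  have sq: "\<theta>\<^sup>2 \<notin> span {\<theta>, 1}"
  proof
    assume "\<theta>\<^sup>2 \<in> span {\<theta>, 1}"
    then obtain a b where ab: "\<theta>\<^sup>2 = of_rat a + of_rat b * \<theta>"
      using span2 by auto
    have "span {\<theta>, 1} \<noteq> UNIV"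
    proof
      assume "span {\<theta>, 1} = UNIV"
      then have "card B \<le> card {\<theta>, 1}"
        using independent_span_bound[of "{\<theta>, 1}" B] B by simp
      with B(3) \<open>card {\<theta>, 1} = 2\<close> show False by simp
    qed
    then obtain y where y: "y \<notin> span {\<theta>, 1}" by auto
    then obtain e f c where "\<theta> * y = of_rat e + of_rat f * \<theta> + of_rat c * y"
      using full[of "{y, \<theta>, 1}" "\<theta> * y"] ind3[OF y] span3 by auto
    then have 1: "(\<theta> - of_rat c) * y = of_rat e + of_rat f * \<theta>"
      by (simp add: algebra_simps)
    \<comment> \<open>From \<open>\<theta>\<^sup>2 = a + b * \<theta>\<close> the conjugate of
      \<theta> is \<open>b - \<theta>\<close>. Hence \<open>\<theta> - c\<close> times
      \<open>\<theta> - (b - c)\<close> is, up to sign, a norm and thus rational; multiplying by the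
      second factor frees \<open>y\<close> from its coefficient.\<close>
    define n where "n = a + c * (b - c)"
    have n: "(\<theta> - of_rat c) * (\<theta> - of_rat (b - c)) = of_rat n"
      using ab by (simp add: n_def of_rat_add of_rat_mult of_rat_diff power2_eq_square algebra_simps)
    have "\<theta> \<noteq> of_rat c" "\<theta> \<noteq> of_rat (b - c)"
      using irrat by auto
    with n have n0: "n \<noteq> 0" by (metis mult_eq_0_iff of_rat_0 right_minus_eq)
    have "of_rat n * y = (\<theta> - of_rat (b - c)) * (of_rat e + of_rat f * \<theta>)"
      unfolding n[symmetric] 1[symmetric] by (simp add: algebra_simps)
    also have "\<dots> = of_rat f * \<theta>\<^sup>2 + of_rat (e - (b - c) * f) * \<theta> - of_rat ((b - c) * e)"
      by (simp add: of_rat_add of_rat_mult of_rat_diff power2_eq_square algebra_simps)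
    also have "\<dots> = of_rat (f * a - (b - c) * e) + of_rat (e + f * b - (b - c) * f) * \<theta>"
      by (simp add: ab of_rat_add of_rat_mult of_rat_diff algebra_simps)
    finally have "y = of_rat ((f * a - (b - c) * e) / n) + of_rat ((e + f * b - (b - c) * f) / n) * \<theta>"
      using n0 by (simp add: of_rat_divide field_simps)
    with y span2 show False by blast
  qed
  note ind = ind3[OF sq]
  have sp: "\<exists>a b c. x = of_rat a + of_rat b * \<theta> + of_rat c * \<theta>\<^sup>2" for x
    using full[of "{\<theta>\<^sup>2, \<theta>, 1}" x] ind span3 by auto
  have li: "a = 0 \<and> b = 0 \<and> c = 0" if "of_rat a + of_rat b * \<theta> + of_rat c * \<theta>\<^sup>2 = 0" for a b c
  proof -
    have "c = 0"
    proof (rule ccontr)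
      assume "c \<noteq> 0"
      then have "\<theta>\<^sup>2 = of_rat (- a / c) + of_rat (- b / c) * \<theta>"
        using that by (simp add: of_rat_divide of_rat_minus field_simps) (simp add: add_eq_0_iff algebra_simps)
      with sq span2 show False by blast
    qed
    moreover have "b = 0"
    proof (rule ccontr)
      assume "b \<noteq> 0"
      then have "\<theta> = of_rat (- a / b)"
        using that \<open>c = 0\<close> by (simp add: of_rat_divide of_rat_minus field_simps add_eq_0_iff)
      with irrat show False by blast
    qed
    ultimately show ?thesis using that by simp
  qed
  from sp[of "\<theta> ^ 3"] sp li show ?thesis
    unfolding cubic_generator_def by blast
qed

lemma cubic_field_irrational:
  assumes "cubic_field TYPE('k::field_char_0)"
  shows "\<exists>\<theta>::'k. \<theta> \<notin> range of_rat"
proof (rule ccontr)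
  assume *: "\<not> ?thesis"
  interpret vector_space "\<lambda>(q::rat) (x::'k). of_rat q * x"
    by (rule vector_space_of_rat)
  have "UNIV \<subseteq> span {1}"
    using * by (auto simp: span_singleton)
  then have "dim UNIV \<le> card {1::'k}"
    by (rule dim_le_card) simp
  with assms show False
    by (simp add: cubic_field_def)
qed

section \<open>The inner product on the Minkowski space\<close>

lemma minkowski_inner_commute: "minkowski_inner u v = minkowski_inner v u"
  by (simp add: minkowski_inner_def mult.commute)

lemma minkowski_inner_add_left:
  "minkowski_inner (\<lambda>\<sigma>. u \<sigma> + v \<sigma>) w = minkowski_inner u w + minkowski_inner v w"
  by (simp add: minkowski_inner_def ring_distribs sum.distrib)

lemma minkowski_inner_scale_left:
  "minkowski_inner (\<lambda>\<sigma>. of_real a * u \<sigma>) w = a * minkowski_inner u w"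
  by (simp add: minkowski_inner_def mult.assoc flip: sum_distrib_left)

lemma minkowski_inner_scale_right:
  "minkowski_inner w (\<lambda>\<sigma>. of_real a * u \<sigma>) = a * minkowski_inner w u"
  by (metis minkowski_inner_commute minkowski_inner_scale_left)

lemma minkowski_inner_diff_left:
  "minkowski_inner (\<lambda>\<sigma>. u \<sigma> - v \<sigma>) w = minkowski_inner u w - minkowski_inner v w"
  by (simp add: minkowski_inner_def ring_distribs sum_subtractf)

lemma minkowski_inner_diff_right:
  "minkowski_inner w (\<lambda>\<sigma>. u \<sigma> - v \<sigma>) = minkowski_inner w u - minkowski_inner w v"
  by (metis minkowski_inner_commute minkowski_inner_diff_left)

lemma minkowski_inner_nonneg: "0 \<le> minkowski_inner v v"
  unfolding minkowski_inner_def Re_sum by (intro sum_nonneg) simp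

text \<open>Elements of \<open>minkowski_space\<close> are sums over a set of field elements, so for
  \<open>x = y\<close> the two terms must first be merged into one with coefficient
  \<open>a + b\<close>.\<close>

lemma minkowski_space_combination:
  "(\<lambda>\<sigma>. of_real a * minkowski_embedding x \<sigma> + of_real b * minkowski_embedding y \<sigma>) \<in> minkowski_space"
proof (cases "x = y")
  case True
  then show ?thesis
    unfolding minkowski_space_def
    by (intro CollectI exI[of _ "{x}"] exI[of _ "\<lambda>_. a + b"]) (simp add: algebra_simps)
next
  case False
  then show ?thesis
    unfolding minkowski_space_def
    by (intro CollectI exI[of _ "{x, y}"] exI[of _ "\<lambda>z. if z = x then a else b"]) simp
qed

text \<open>The assumption says that there are finitely many complex embeddings and at least one.
  Otherwise the quotient in the projection would be a division by 0.\<close>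

lemma proj_one_complement_in:
  fixes x :: "'k::field_char_0"
  assumes "minkowski_inner (minkowski_embedding (1::'k)) (minkowski_embedding 1) \<noteq> 0"
  shows "proj_one_complement (minkowski_embedding x) \<in> one_complement"
proof -
  have "proj_one_complement (minkowski_embedding x) \<in> minkowski_space"
    using minkowski_space_combination[of 1 x _ 1, of "- _"]
    by (simp add: proj_one_complement_def Let_def del: of_real_divide)
  then show ?thesis
    using assms
    by (simp add: one_complement_def proj_one_complement_def Let_def minkowski_inner_diff_left
        minkowski_inner_scale_left del: of_real_divide)
qed

text \<open>Intermediate value theorem on \<open>{- M..M}\<close>. This root is what gives a cubic
  field a real embedding, whatever its signature.\<close>

lemma real_cubic_root_exists: "\<exists>x::real. x ^ 3 = p + q * x + r * x\<^sup>2"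
proof -
  define f where "f x = x ^ 3 - (p + q * x + r * x\<^sup>2)" for x :: real
  \<comment> \<open>Chosen so that \<open>M ^ 3\<close> is \<open>M\<^sup>2\<close> times the sum of
    1 and the absolute values of the coefficients; as \<open>M \<ge> 1\<close>, it dominates the
    quadratic part at both endpoints.\<close>
  define M where "M = 1 + \<bar>p\<bar> + \<bar>q\<bar> + \<bar>r\<bar>"
  have M: "M \<ge> 1" by (simp add: M_def)
  then have M2: "M \<le> M\<^sup>2" "1 \<le> M\<^sup>2"
    using self_le_power[of M 2] by simp_all
  have "\<bar>p + q * x + r * x\<^sup>2\<bar> \<le> M ^ 3" if "\<bar>x\<bar> = M" for x
  proof -
    have x2: "x\<^sup>2 = M\<^sup>2" using that by (metis power2_abs)
    have "\<bar>p + q * x + r * x\<^sup>2\<bar> \<le> \<bar>p\<bar> + \<bar>q * x\<bar> + \<bar>r * x\<^sup>2\<bar>"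
      by linarith
    also have "\<dots> = \<bar>p\<bar> + \<bar>q\<bar> * M + \<bar>r\<bar> * M\<^sup>2"
      by (simp add: abs_mult that x2)
    also have "\<dots> \<le> \<bar>p\<bar> * M\<^sup>2 + \<bar>q\<bar> * M\<^sup>2 + \<bar>r\<bar> * M\<^sup>2 + M\<^sup>2"
      using M2 mult_left_mono[of 1 "M\<^sup>2" "\<bar>p\<bar>"] mult_left_mono[of M "M\<^sup>2" "\<bar>q\<bar>"] by auto
    also have "\<dots> = M ^ 3"
      by (simp add: M_def power3_eq_cube power2_eq_square algebra_simps)
    finally show ?thesis .
  qed
  from this[of M] this[of "- M"] M have "f M \<ge> 0" "f (- M) \<le> 0"
    by (auto simp: f_def abs_le_iff)
  moreover have "continuous_on {- M..M} f"
    unfolding f_def by (intro continuous_intros)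
  ultimately obtain x where "f x = 0"
    using IVT'[of f "- M" 0 M] M by auto
  then show ?thesis by (auto simp: f_def)
qed

section \<open>Embeddings as evaluations at the roots of the cubic\<close>

context cubic_generator
begin

lemma coord_unique:
  assumes "of_rat a + of_rat b * \<theta> + of_rat c * \<theta>\<^sup>2 = of_rat a' + of_rat b' * \<theta> + of_rat c' * \<theta>\<^sup>2"
  shows "a = a' \<and> b = b' \<and> c = c'"
  using indep[of "a - a'" "b - b'" "c - c'"] assms by (simp add: of_rat_diff algebra_simps)

text \<open>The rational-linear map that sends 1, \<theta>, \<open>\<theta>\<^sup>2\<close> to 1,
  \<open>z\<close>, \<open>z\<^sup>2\<close>. It makes sense for every \<open>z\<close> and is a
  field homomorphism exactly when \<open>z\<close> is a root. The target type stays open because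
  both real and complex values are used.\<close>

definition eval_at :: "'a::field_char_0 \<Rightarrow> 'k \<Rightarrow> 'a" where
  "eval_at z x = (THE y. \<exists>a b c. x = of_rat a + of_rat b * \<theta> + of_rat c * \<theta>\<^sup>2 \<and>
                    y = of_rat a + of_rat b * z + of_rat c * z\<^sup>2)"

lemma eval_at_eq:
  "eval_at z (of_rat a + of_rat b * \<theta> + of_rat c * \<theta>\<^sup>2) = of_rat a + of_rat b * z + of_rat c * z\<^sup>2"
  unfolding eval_at_def by (rule the_equality) (use coord_unique in blast)+

lemma eval_at_theta: "eval_at z \<theta> = z"
  using eval_at_eq[of z 0 1 0] by simp

lemma eval_at_one: "eval_at z 1 = 1"
  using eval_at_eq[of z 1 0 0] by simp

lemma eval_at_theta_sq: "eval_at z (\<theta>\<^sup>2) = z\<^sup>2"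
  using eval_at_eq[of z 0 0 1] by simp

definition cubic_roots :: "'a::field_char_0 set" where
  "cubic_roots = {z. z ^ 3 = of_rat p + of_rat q * z + of_rat r * z\<^sup>2}"

text \<open>The coordinates of a product depend only on the two factors and on \<open>p\<close>,
  \<open>q\<close>, \<open>r\<close>. The reduction formula \<open>prod\<close> is proved for any
  root in any field and then used twice, at \<theta> and at \<open>z\<close>.\<close>

lemma field_hom_eval_at:
  fixes z :: "'a::field_char_0"
  assumes "z \<in> cubic_roots"
  shows "field_hom (eval_at z)"
proof -
  have z: "z ^ 3 = of_rat p + of_rat q * z + of_rat r * z\<^sup>2"
    using assms by (simp add: cubic_roots_def)
  have prod: "(of_rat a + of_rat b * t + of_rat c * t\<^sup>2) * (of_rat a' + of_rat b' * t + of_rat c' * t\<^sup>2) =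
      of_rat (a * a' + (b * c' + c * b') * p + c * c' * r * p)
      + of_rat (a * b' + b * a' + (b * c' + c * b') * q + c * c' * (p + r * q)) * t
      + of_rat (a * c' + b * b' + c * a' + (b * c' + c * b') * r + c * c' * (q + r * r)) * t\<^sup>2"
    if t: "t ^ 3 = of_rat p + of_rat q * t + of_rat r * t\<^sup>2"
    for t :: "'b::field_char_0" and a b c a' b' c'
  proof -
    have "(of_rat a + of_rat b * t + of_rat c * t\<^sup>2) * (of_rat a' + of_rat b' * t + of_rat c' * t\<^sup>2) =
      of_rat (a * a') + of_rat (a * b' + b * a') * t + of_rat (a * c' + b * b' + c * a') * t\<^sup>2
      + of_rat (b * c' + c * b') * t ^ 3 + of_rat (c * c') * (t * t ^ 3)"
      by (simp add: of_rat_add of_rat_mult algebra_simps power2_eq_square power3_eq_cube)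
    also have "t * t ^ 3 = of_rat p * t + of_rat q * t\<^sup>2 + of_rat r * t ^ 3"
      by (subst t) (simp add: algebra_simps power2_eq_square power3_eq_cube)
    finally show ?thesis
      unfolding t by (simp add: of_rat_add of_rat_mult algebra_simps)
  qed
  show ?thesis
    unfolding field_hom_def
  proof (intro conjI allI)
    show "eval_at z 1 = 1" by (rule eval_at_one)
    fix x y :: 'k
    obtain a b c where x: "x = of_rat a + of_rat b * \<theta> + of_rat c * \<theta>\<^sup>2"
      using spanning by blast
    obtain a' b' c' where y: "y = of_rat a' + of_rat b' * \<theta> + of_rat c' * \<theta>\<^sup>2"
      using spanning by blast
    have sum: "x + y = of_rat (a + a') + of_rat (b + b') * \<theta> + of_rat (c + c') * \<theta>\<^sup>2"
      by (simp add: x y of_rat_add algebra_simps)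
    show "eval_at z (x + y) = eval_at z x + eval_at z y"
      unfolding sum unfolding x y eval_at_eq by (simp add: of_rat_add algebra_simps)
    show "eval_at z (x * y) = eval_at z x * eval_at z y"
      unfolding x y prod[OF cube] eval_at_eq prod[OF z] ..
  qed
qed

text \<open>A homomorphism fixes the rationals, so it is determined by the image of \<theta>.
  Together with \<open>field_hom_eval_at\<close> this identifies embeddings with roots.\<close>

lemma field_hom_eq_eval_at:
  fixes h :: "'k \<Rightarrow> 'a::field_char_0"
  assumes h: "field_hom h"
  shows "h \<theta> \<in> cubic_roots" "h = eval_at (h \<theta>)"
proof -
  note hom = field_hom_add[OF h] field_hom_mult[OF h] field_hom_power[OF h] field_hom_of_rat[OF h]
  show "h \<theta> \<in> cubic_roots"
    using arg_cong[OF cube, of h] by (simp add: cubic_roots_def hom)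
  show "h = eval_at (h \<theta>)"
  proof
    fix x :: 'k
    obtain a b c where x: "x = of_rat a + of_rat b * \<theta> + of_rat c * \<theta>\<^sup>2"
      using spanning by blast
    show "h x = eval_at (h \<theta>) x"
      unfolding x eval_at_eq by (simp add: hom)
  qed
qed

lemma complex_embeddings_eq: "complex_embeddings = eval_at ` (cubic_roots :: complex set)"
  using field_hom_eval_at field_hom_eq_eval_at by (auto simp: complex_embeddings_def)

lemma sum_complex_embeddings:
  "(\<Sum>\<sigma>\<in>complex_embeddings. g \<sigma>) = (\<Sum>z\<in>cubic_roots. g (eval_at z))"
proof -
  have "inj_on eval_at (cubic_roots :: complex set)"
    by (metis inj_onI eval_at_theta)
  then show ?thesis
    unfolding complex_embeddings_eq by (simp add: sum.reindex)
qed

lemma minkowski_inner_eq: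
  "minkowski_inner u v = Re (\<Sum>z\<in>cubic_roots. u (eval_at z) * cnj (v (eval_at z)))"
  by (simp add: minkowski_inner_def sum_complex_embeddings)

lemma minkowski_embedding_eval_at:
  "z \<in> cubic_roots \<Longrightarrow> minkowski_embedding x (eval_at z) = eval_at z x"
  by (auto simp: minkowski_embedding_def complex_embeddings_eq)

lemma minkowski_inner_embedding:
  "minkowski_inner (minkowski_embedding x) (minkowski_embedding y) =
     Re (\<Sum>z\<in>cubic_roots. eval_at z x * cnj (eval_at z y))"
  unfolding minkowski_inner_eq
  by (intro arg_cong[of _ _ Re] sum.cong) (simp_all add: minkowski_embedding_eval_at)

lemma eval_at_of_real:
  "eval_at (complex_of_real t) x = of_real (eval_at t x)"
proof -
  obtain a b c where x: "x = of_rat a + of_rat b * \<theta> + of_rat c * \<theta>\<^sup>2"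
    using spanning by blast
  have "complex_of_real (of_rat e) = of_rat e" for e
    by (cases e) (simp add: of_rat_rat)
  then show ?thesis
    unfolding x eval_at_eq by simp
qed

text \<open>Dividing the cubic by \<open>z - \<rho>\<close> leaves a real quadratic;
  \<open>u\<close> is half the sum of its roots and \<open>d\<close> a quarter of its discriminant.
  Using \<open>csqrt\<close> treats both signs of \<open>d\<close> at once.\<close>

lemma cubic_roots_real_root:
  fixes \<rho> :: real
  assumes \<rho>: "\<rho> \<in> cubic_roots"
  defines "u \<equiv> (of_rat r - \<rho>) / 2"
  defines "d \<equiv> u\<^sup>2 - (\<rho>\<^sup>2 - of_rat r * \<rho> - of_rat q)"
  shows "cubic_roots = {complex_of_real \<rho>, of_real u + csqrt (of_real d), of_real u - csqrt (of_real d)}"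
proof -
  have rat: "complex_of_real (of_rat e) = of_rat e" for e
    by (cases e) (simp add: of_rat_rat)
  have "z \<in> cubic_roots \<longleftrightarrow> z = \<rho> \<or> z = u + csqrt d \<or> z = u - csqrt d" for z :: complex
  proof -
    have p: "of_rat p = \<rho> ^ 3 - of_rat q * \<rho> - of_rat r * \<rho>\<^sup>2"
      using \<rho> by (simp add: cubic_roots_def)
    have cp: "(of_rat p :: complex) = of_real \<rho> ^ 3 - of_rat q * of_real \<rho> - of_rat r * (of_real \<rho>)\<^sup>2"
      using arg_cong[OF p, of complex_of_real] by (simp add: rat)
    define R where "R = complex_of_real \<rho>"
    have d: "complex_of_real d = ((of_rat r - R) / 2)\<^sup>2 - (R\<^sup>2 - of_rat r * R - of_rat q)"
      by (simp add: d_def u_def rat R_def)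
    have u: "complex_of_real u = (of_rat r - R) / 2"
      by (simp add: u_def rat R_def)
    have "z ^ 3 - (of_rat p + of_rat q * z + of_rat r * z\<^sup>2) = (z - \<rho>) * ((z - u)\<^sup>2 - of_real d)"
      unfolding cp d u R_def[symmetric] by (simp add: field_simps power2_eq_square power3_eq_cube)
    also have "of_real d = (csqrt d)\<^sup>2" by simp
    also have "(z - u)\<^sup>2 - (csqrt d)\<^sup>2 = (z - (u + csqrt d)) * (z - (u - csqrt d))"
      by (simp add: power2_eq_square algebra_simps)
    finally show ?thesis
      by (auto simp: cubic_roots_def)
  qed
  then show ?thesis by auto
qed

text \<open>The cases are whether the square root \<open>w\<close> of \<open>d\<close> lies in
  \<open>F\<close>. If it does, each summand is in \<open>F\<close>; if not, the summands at
  \<open>u + w\<close> and \<open>u - w\<close> have to be added before they land there.\<close>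

lemma minkowski_inner_in_real_field:
  fixes \<rho> :: real and x :: 'k
  assumes \<rho>: "\<rho> \<in> cubic_roots"
  defines "F \<equiv> range (eval_at \<rho> :: 'k \<Rightarrow> real)"
  shows "minkowski_inner (minkowski_embedding x) (minkowski_embedding 1) \<in> F"
    and "minkowski_inner (minkowski_embedding x) (minkowski_embedding x) \<in> F"
proof -
  have F: "is_subfield F"
    unfolding F_def by (intro is_subfield_range_field_hom field_hom_eval_at \<rho>)
  note Fcl = is_subfieldD[OF F] of_rat_in_subfield[OF F]
  have "\<rho> \<in> F"
    unfolding F_def by (metis eval_at_theta rangeI)
  define u where "u = (of_rat r - \<rho>) / 2"
  define d where "d = u\<^sup>2 - (\<rho>\<^sup>2 - of_rat r * \<rho> - of_rat q)"
  define w where "w = csqrt (of_real d)"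
  have roots: "cubic_roots = {complex_of_real \<rho>, of_real u + w, of_real u - w}"
    using cubic_roots_real_root[OF \<rho>] by (simp add: u_def d_def w_def)
  have two: "2 \<in> F" using Fcl(4)[OF Fcl(1) Fcl(1)] by simp
  have u: "u \<in> F" unfolding u_def by (intro Fcl \<open>\<rho> \<in> F\<close> two)
  have d: "d \<in> F" unfolding d_def by (intro Fcl \<open>\<rho> \<in> F\<close> u)
  \<comment> \<open>The absolute value is not a field operation, but it only changes the sign of
    \<open>d\<close>.\<close>
  then have abs_d: "\<bar>d\<bar> \<in> F" by (simp add: abs_if Fcl)
  obtain a b c where x: "x = of_rat a + of_rat b * \<theta> + of_rat c * \<theta>\<^sup>2"
    using spanning by blast
  have rat: "complex_of_real (of_rat e) = of_rat e" for e
    by (cases e) (simp add: of_rat_rat)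
  have "Re (\<Sum>z\<in>cubic_roots. eval_at (z::complex) x) \<in> F \<and>
        Re (\<Sum>z\<in>cubic_roots. eval_at (z::complex) x * cnj (eval_at z x)) \<in> F"
  proof (cases "w \<in> of_real ` F")
    \<comment> \<open>All roots lie in \<open>F\<close>; coinciding roots, if any, do no harm here.\<close>
    case True
    have real: "\<exists>t\<in>F. eval_at z x = of_real t" if z: "z \<in> cubic_roots" for z :: complex
    proof -
      obtain v where v: "v \<in> F" "w = of_real v"
        using True by auto
      have "z = of_real \<rho> \<or> z = of_real (u + v) \<or> z = of_real (u - v)"
        using z by (auto simp: roots v)
      moreover have "u + v \<in> F" "u - v \<in> F"
        by (intro Fcl u v)+
      ultimately obtain s where s: "s \<in> F" "z = of_real s"
        using \<open>\<rho> \<in> F\<close> by blast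
      have "eval_at s x \<in> F"
        unfolding x eval_at_eq by (intro Fcl s)
      then show ?thesis
        using s by (auto simp: eval_at_of_real)
    qed
    then obtain f where f: "f z \<in> F" "eval_at z x = of_real (f z)" if "z \<in> cubic_roots" for z :: complex
      by metis
    show ?thesis
      by (auto simp: f intro!: sum_in_subfield[OF F] Fcl)
  next
    \<comment> \<open>The roots are distinct, and both sums are symmetric under \<open>w \<mapsto> - w\<close>. Whether \<open>w\<close> is real or
      imaginary only affects the sign in \<open>w * cnj w = \<bar>d\<bar>\<close>.\<close>
    case False
    have "w \<noteq> 0" "of_real u + w \<noteq> \<rho>" "of_real u - w \<noteq> \<rho>"
    proof -
      show "w \<noteq> 0" using False Fcl(2) by auto
      have "\<rho> - u \<in> F" "u - \<rho> \<in> F" by (intro Fcl \<open>\<rho> \<in> F\<close> u)+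
      then show "of_real u + w \<noteq> \<rho>" "of_real u - w \<noteq> \<rho>"
        using False by (auto simp: image_iff algebra_simps)
    qed
    then have distinct: "of_real \<rho> \<noteq> of_real u + w" "of_real \<rho> \<noteq> of_real u - w" "of_real u + w \<noteq> of_real u - w"
      by auto
    have w2: "w\<^sup>2 = of_real d" by (simp add: w_def)
    have "(norm w)\<^sup>2 = \<bar>d\<bar>"
      using w2 by (metis norm_of_real norm_power)
    then have wc: "w * cnj w = of_real \<bar>d\<bar>"
      by (simp add: complex_norm_square[symmetric])
    \<comment> \<open>Even and odd powers of \<open>w\<close> are separated using
      \<open>w\<^sup>2 = d\<close>, so the values at the two roots are \<open>A + B * w\<close> and
      \<open>A - B * w\<close> with real coefficients in \<open>F\<close>.\<close>
    define A where "A = of_rat a + of_rat b * u + of_rat c * (u\<^sup>2 + d)"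
    define B where "B = of_rat b + of_rat c * (2 * u)"
    have A: "A \<in> F" unfolding A_def by (intro Fcl u d)
    have B: "B \<in> F" unfolding B_def by (intro Fcl u two)
    have ev1: "eval_at (of_real u + w) x = of_real A + of_real B * w"
      unfolding x eval_at_eq
      by (simp add: A_def B_def rat algebra_simps power2_eq_square flip: w2)
    have ev2: "eval_at (of_real u - w) x = of_real A - of_real B * w"
      unfolding x eval_at_eq
      by (simp add: A_def B_def rat algebra_simps power2_eq_square flip: w2)
    have "(\<Sum>z\<in>cubic_roots. eval_at (z::complex) x) = of_real (eval_at \<rho> x + 2 * A)"
      unfolding roots using distinct by (simp add: ev1 ev2 eval_at_of_real)
    \<comment> \<open>The mixed terms in \<open>A * B\<close> have opposite signs at the two roots
      and cancel.\<close>
    moreover have "(\<Sum>z\<in>cubic_roots. eval_at (z::complex) x * cnj (eval_at z x)) =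
        of_real ((eval_at \<rho> x)\<^sup>2) + 2 * of_real (A\<^sup>2) + 2 * of_real (B\<^sup>2) * (w * cnj w)"
      unfolding roots using distinct
      by (simp add: ev1 ev2 eval_at_of_real) (simp add: algebra_simps power2_eq_square)
    then have "(\<Sum>z\<in>cubic_roots. eval_at (z::complex) x * cnj (eval_at z x)) =
        of_real ((eval_at \<rho> x)\<^sup>2 + 2 * A\<^sup>2 + 2 * B\<^sup>2 * \<bar>d\<bar>)"
      by (simp add: wc)
    moreover have "eval_at \<rho> x \<in> F" by (simp add: F_def)
    ultimately show ?thesis
      by (simp del: of_real_add of_real_mult of_real_power) (intro conjI Fcl A B two abs_d)
  qed
  then show "minkowski_inner (minkowski_embedding x) (minkowski_embedding 1) \<in> F"
    and "minkowski_inner (minkowski_embedding x) (minkowski_embedding x) \<in> F"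
    by (simp_all add: minkowski_inner_embedding eval_at_one)
qed

end

section \<open>Squared lengths of projected elements\<close>

context cubic_generator
begin

text \<open>The value counts the complex embeddings. The explicit list of roots shows that the count
  is finite and positive, which is what \<open>proj_one_complement_in\<close> asks for.\<close>

lemma minkowski_inner_one_pos:
  "0 < minkowski_inner (minkowski_embedding (1::'k)) (minkowski_embedding 1)"
proof -
  obtain \<rho> :: real where \<rho>: "\<rho> \<in> cubic_roots"
    using real_cubic_root_exists[of "of_rat p" "of_rat q" "of_rat r"] by (auto simp: cubic_roots_def)
  have "finite (cubic_roots :: complex set)" "(cubic_roots :: complex set) \<noteq> {}"
    unfolding cubic_roots_real_root[OF \<rho>] by auto
  then show ?thesis
    by (simp add: minkowski_inner_embedding eval_at_one card_gt_0_iff)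
qed

text \<open>By Pythagoras the projection subtracts the square of the product with 1, divided by the
  squared length of 1. This uses field operations only.\<close>

lemma minkowski_inner_proj_in_real_field:
  fixes \<rho> :: real and x :: 'k
  assumes \<rho>: "\<rho> \<in> cubic_roots"
  defines "v \<equiv> proj_one_complement (minkowski_embedding x)"
  shows "minkowski_inner v v \<in> range (eval_at \<rho> :: 'k \<Rightarrow> real)"
proof -
  let ?x = "minkowski_embedding x" and ?e = "minkowski_embedding (1::'k)"
  let ?F = "range (eval_at \<rho> :: 'k \<Rightarrow> real)"
  define c where "c = minkowski_inner ?x ?e / minkowski_inner ?e ?e"
  have F: "is_subfield ?F"
    by (intro is_subfield_range_field_hom field_hom_eval_at \<rho>)
  note in_F = minkowski_inner_in_real_field[OF \<rho>]
  have c: "c \<in> ?F"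
    unfolding c_def by (intro is_subfieldD(6)[OF F] in_F)
  have "minkowski_inner v v = minkowski_inner ?x ?x - c * minkowski_inner ?x ?e
      - c * (minkowski_inner ?x ?e - c * minkowski_inner ?e ?e)"
    unfolding v_def proj_one_complement_def Let_def c_def[symmetric]
    by (simp add: minkowski_inner_diff_left minkowski_inner_diff_right minkowski_inner_scale_left
        minkowski_inner_scale_right minkowski_inner_commute[of ?e ?x] algebra_simps)
  then show ?thesis
    by (simp only:) (intro is_subfieldD[OF F] c in_F)
qed

end

section \<open>Invariance of the shape under isomorphism\<close>

text \<open>Embeddings \<tau> of the target restrict along \<eta> to embeddings of the source.
  Vectors, being functions of embeddings, therefore move in the same direction as \<eta>.\<close>

definition pull :: "('a \<Rightarrow> 'b) \<Rightarrow> (('a \<Rightarrow> complex) \<Rightarrow> complex) \<Rightarrow> ('b \<Rightarrow> complex) \<Rightarrow> complex" where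
  "pull \<eta> v = (\<lambda>\<tau>. v (\<tau> \<circ> \<eta>))"

context
  fixes \<eta> :: "'a::field_char_0 \<Rightarrow> 'b::field_char_0"
  assumes hom: "field_hom \<eta>" and bij: "bij \<eta>"
begin

text \<open>Both directions matter: \<open>minkowski_embedding\<close> takes the default value 0 off
  the embeddings, and reindexing has to respect that. The converse composes with
  \<open>inv \<eta>\<close>.\<close>

lemma comp_in_complex_embeddings: "\<tau> \<circ> \<eta> \<in> complex_embeddings \<longleftrightarrow> \<tau> \<in> complex_embeddings"
proof
  assume "\<tau> \<circ> \<eta> \<in> complex_embeddings"
  then have "field_hom (\<tau> \<circ> \<eta> \<circ> inv \<eta>)"
    by (intro field_hom_comp[OF _ field_hom_inv[OF hom bij]]) (simp add: complex_embeddings_def)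
  then show "\<tau> \<in> complex_embeddings"
    using bij_is_surj[OF bij] by (simp add: complex_embeddings_def comp_assoc surj_iff)
qed (simp add: complex_embeddings_def field_hom_comp hom)

lemma pull_minkowski_embedding: "pull \<eta> (minkowski_embedding x) = minkowski_embedding (\<eta> x)"
  by (simp add: pull_def minkowski_embedding_def comp_in_complex_embeddings fun_eq_iff)

lemma minkowski_inner_pull: "minkowski_inner (pull \<eta> u) (pull \<eta> v) = minkowski_inner u v"
proof -
  have "bij_betw (\<lambda>\<tau>. \<tau> \<circ> \<eta>) complex_embeddings complex_embeddings"
  proof (rule bij_betwI[where g = "\<lambda>\<sigma>. \<sigma> \<circ> inv \<eta>"])
    show "(\<lambda>\<sigma>. \<sigma> \<circ> inv \<eta>) \<in> complex_embeddings \<rightarrow> complex_embeddings"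
      by (auto simp: complex_embeddings_def intro: field_hom_comp field_hom_inv hom bij)
  qed (use bij in \<open>auto simp: comp_in_complex_embeddings comp_assoc surj_iff[THEN iffD1, OF bij_is_surj]
         inv_o_cancel bij_is_inj\<close>)
  from sum.reindex_bij_betw[OF this] show ?thesis
    by (simp add: minkowski_inner_def pull_def)
qed

lemma pull_minkowski_space:
  assumes "v \<in> minkowski_space"
  shows "pull \<eta> v \<in> minkowski_space"
proof -
  from assms obtain S c where S: "finite S"
    and v: "v = (\<lambda>\<sigma>. \<Sum>x\<in>S. of_real (c x) * minkowski_embedding x \<sigma>)"
    by (auto simp: minkowski_space_def)
  have "minkowski_embedding x (\<tau> \<circ> \<eta>) = minkowski_embedding (\<eta> x) \<tau>" for x \<tau>
    using fun_cong[OF pull_minkowski_embedding] by (simp add: pull_def)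
  then have "pull \<eta> v = (\<lambda>\<tau>. \<Sum>y\<in>\<eta> ` S. of_real (c (inv \<eta> y)) * minkowski_embedding y \<tau>)"
    using bij_is_inj[OF bij]
    by (simp add: pull_def v sum.reindex inj_on_subset[OF _ subset_UNIV])
  then show ?thesis
    unfolding minkowski_space_def
    by (intro CollectI exI[of _ "\<eta> ` S"] exI[of _ "\<lambda>y. c (inv \<eta> y)"] conjI finite_imageI S)
qed

lemma pull_one_complement: "v \<in> one_complement \<Longrightarrow> pull \<eta> v \<in> one_complement"
  using minkowski_inner_pull[of v "minkowski_embedding 1"]
  by (simp add: one_complement_def pull_minkowski_space pull_minkowski_embedding field_hom_one[OF hom])

lemma pull_proj_one_complement:
  "pull \<eta> (proj_one_complement v) = proj_one_complement (pull \<eta> v)"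
proof -
  have e: "minkowski_embedding 1 = pull \<eta> (minkowski_embedding 1)"
    by (simp add: pull_minkowski_embedding field_hom_one[OF hom])
  show ?thesis
    unfolding proj_one_complement_def Let_def e minkowski_inner_pull by (simp add: pull_def)
qed

lemma pull_integers_perp: "v \<in> integers_perp \<Longrightarrow> pull \<eta> v \<in> integers_perp"
  by (auto simp: integers_perp_def ring_of_integers_def pull_proj_one_complement
      pull_minkowski_embedding intro: algebraic_int_field_hom[OF hom])

end

lemma pull_inv:
  assumes "bij \<eta>"
  shows "pull \<eta> (pull (inv \<eta>) v) = v"
  using bij_is_surj[OF assms] by (simp add: pull_def comp_assoc surj_iff)

text \<open>\<open>pull \<psi>\<close> is a linear isometry between the two complements that carries
  one lattice onto the other. Composing a similitude with it yields a similitude with the same image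
  lattice.\<close>

lemma shape_subset:
  fixes \<psi> :: "'l::field_char_0 \<Rightarrow> 'k::field_char_0"
  assumes "field_hom \<psi>" "bij \<psi>"
  shows "shape TYPE('k) \<subseteq> shape TYPE('l)"
proof
  fix X assume "X \<in> shape TYPE('k)"
  then obtain f :: "(('k \<Rightarrow> complex) \<Rightarrow> complex) \<Rightarrow> real ^ 2"
    where f: "similitude f" and X: "X = f ` integers_perp"
    by (auto simp: shape_def)
  note inv = field_hom_inv[OF assms] bij_imp_bij_inv[OF assms(2)]
  \<comment> \<open>Surjectivity comes from pulling back along the inverse isomorphism.\<close>
  have oc: "pull \<psi> ` one_complement = one_complement"
    using pull_one_complement[OF assms] pull_one_complement[OF inv]
    by (auto intro: image_eqI[where f = "pull \<psi>", OF sym[OF pull_inv[OF assms(2)]]])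
  have ip: "pull \<psi> ` integers_perp = integers_perp"
    using pull_integers_perp[OF assms] pull_integers_perp[OF inv]
    by (auto intro: image_eqI[where f = "pull \<psi>", OF sym[OF pull_inv[OF assms(2)]]])
  have lin: "pull \<psi> (\<lambda>\<sigma>. u \<sigma> + v \<sigma>) = (\<lambda>\<sigma>. pull \<psi> u \<sigma> + pull \<psi> v \<sigma>)"
    "pull \<psi> (\<lambda>\<sigma>. of_real a * v \<sigma>) = (\<lambda>\<sigma>. of_real a * pull \<psi> v \<sigma>)" for u v a
    by (simp_all add: pull_def)
  have "similitude (f \<circ> pull \<psi>)"
    using f unfolding similitude_def image_comp[symmetric] oc
    by (fastforce simp: lin pull_one_complement[OF assms] minkowski_inner_pull[OF assms])
  moreover have "X = (f \<circ> pull \<psi>) ` integers_perp"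
    unfolding X image_comp[symmetric] ip ..
  ultimately show "X \<in> shape TYPE('l)"
    unfolding shape_def by (intro CollectI exI conjI)
qed

lemma isomorphic_fields_imp_shape_eq:
  assumes "isomorphic_fields TYPE('l::field_char_0) TYPE('k::field_char_0)"
  shows "shape TYPE('l) = shape TYPE('k)"
proof -
  from assms obtain \<psi> :: "'l \<Rightarrow> 'k" where \<psi>: "field_hom \<psi>" "bij \<psi>"
    by (auto simp: isomorphic_fields_def)
  show ?thesis
    using shape_subset[OF \<psi>] shape_subset[OF field_hom_inv[OF \<psi>] bij_imp_bij_inv[OF \<psi>(2)]] by simp
qed

text \<open>Composing the real embedding with the isomorphism keeps its range. This turns the
  isomorphism obtained from equal shapes into a contradiction when the other field is not
  pure.\<close>

lemma isomorphic_fields_pure: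
  assumes "isomorphic_fields TYPE('l::field_char_0) TYPE('k::field_char_0)"
    and "pure_cubic_field TYPE('k)"
  shows "pure_cubic_field TYPE('l)"
proof -
  from assms(1) obtain \<psi> :: "'l \<Rightarrow> 'k" where \<psi>: "field_hom \<psi>" "bij \<psi>"
    by (auto simp: isomorphic_fields_def)
  from assms(2) obtain m and \<phi> :: "'k \<Rightarrow> real" where
    m: "m > 0" "\<nexists>n. n ^ 3 = m" and \<phi>: "field_hom \<phi>" "range \<phi> = generated_subfield {root 3 (real m)}"
    unfolding pure_cubic_field_def by blast
  have "range (\<phi> \<circ> \<psi>) = range \<phi>"
    using bij_is_surj[OF \<psi>(2)] by (metis image_comp)
  with m \<phi> field_hom_comp[OF \<phi>(1) \<psi>(1)] show ?thesis
    unfolding pure_cubic_field_def by (intro exI[of _ m] exI[of _ "\<phi> \<circ> \<psi>"] conjI) simp_all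
qed

section \<open>Pure cubic fields\<close>

text \<open>A rational algebraic integer is an integer, and a nonnegative one here, so
  \<open>m\<close> would be the cube of a natural number.\<close>

lemma cube_root_irrational:
  fixes m :: nat
  assumes "\<nexists>n::nat. n ^ 3 = m"
  shows "root 3 (real m) \<notin> \<rat>"
proof
  assume "root 3 (real m) \<in> \<rat>"
  moreover have "algebraic_int (root 3 (real m))"
    by (intro algebraic_int_nth_root_real int_imp_algebraic_int) simp
  ultimately have "root 3 (real m) \<in> \<int>"
    by (rule rational_algebraic_int_is_int[rotated])
  then obtain k where k: "root 3 (real m) = of_int k"
    by (auto elim: Ints_cases)
  then have "k \<ge> 0"
    by (metis of_int_0_le_iff of_nat_0_le_iff real_root_ge_zero)
  then have "root 3 (real m) = real (nat k)" by (simp add: k)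
  then have "real (nat k) ^ 3 = real m"
    by (metis of_nat_0_le_iff real_root_pow_pos2 zero_less_numeral)
  then have "nat k ^ 3 = m"
    by (metis of_nat_eq_iff of_nat_power)
  with assms show False by blast
qed

section \<open>The subfield of the reals generated by a cube root\<close>

context
  fixes m :: nat and \<alpha> :: real
  assumes cube: "\<alpha> ^ 3 = real m" and irrat: "\<alpha> \<notin> range of_rat"
begin

text \<open>The two equations say that \<open>a : b\<close>, \<open>b : c\<close> and \<open>m * c : a\<close> coincide, so \<open>m\<close> would be a rational cube.\<close>

lemma cubes_proportional:
  fixes a b c :: rat
  assumes "b\<^sup>2 = a * c" "a * b = of_nat m * c\<^sup>2"
  shows "b = 0 \<and> c = 0"
proof (cases "c = 0")
  case False
  have "b ^ 3 = a * b * c"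
    using assms(1) by (simp add: power3_eq_cube power2_eq_square)
  then have "(b / c) ^ 3 = of_nat m"
    using False assms(2) by (simp add: field_simps power2_eq_square power3_eq_cube)
  then have "of_rat (b / c) ^ 3 = (of_rat (of_nat m) :: real)"
    by (metis of_rat_power)
  then have "of_rat (b / c) ^ 3 = \<alpha> ^ 3"
    by (simp add: cube)
  then have "\<alpha> = of_rat (b / c)"
    by (metis odd_numeral odd_real_root_power_cancel[of 3] numeral_3_eq_3 odd_real_root_unique)
  with irrat show ?thesis by blast
qed (use assms in auto)

text \<open>Multiplying the relation by \<open>b - c * \<alpha>\<close> cancels the
  \<open>\<alpha>\<^sup>2\<close> terms, and \<open>\<alpha> ^ 3 = m\<close> leaves a linear
  relation. As \<alpha> is irrational, both of its coefficients vanish, and these are the equations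
  of \<open>cubes_proportional\<close>.\<close>

lemma cube_root_independent:
  assumes "of_rat a + of_rat b * \<alpha> + of_rat c * \<alpha>\<^sup>2 = 0"
  shows "a = 0 \<and> b = 0 \<and> c = 0"
proof -
  have "of_rat (b\<^sup>2 - a * c) * \<alpha> + of_rat (a * b - of_nat m * c\<^sup>2) =
     (of_rat b - of_rat c * \<alpha>) * (of_rat a + of_rat b * \<alpha> + of_rat c * \<alpha>\<^sup>2) + (of_rat c)\<^sup>2 * (\<alpha> ^ 3 - real m)"
    by (simp add: of_rat_diff of_rat_mult of_rat_power algebra_simps power2_eq_square power3_eq_cube)
  then have *: "of_rat (b\<^sup>2 - a * c) * \<alpha> = - of_rat (a * b - of_nat m * c\<^sup>2)"
    by (simp add: assms cube)
  have "b\<^sup>2 - a * c = 0"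
  proof (rule ccontr)
    assume "b\<^sup>2 - a * c \<noteq> 0"
    then have "\<alpha> = of_rat (- (a * b - of_nat m * c\<^sup>2) / (b\<^sup>2 - a * c))"
      using * by (simp only: of_rat_divide of_rat_minus) (simp add: field_simps)
    with irrat show False by blast
  qed
  with * cubes_proportional[of b a c] have "b = 0 \<and> c = 0" by simp
  with assms show ?thesis by simp
qed

text \<open>Makes the span one of the fields in the intersection \<open>generated_subfield\<close>,
  so that every element of the generated field has coordinates. Only inverses require an
  idea.\<close>

lemma is_subfield_cube_root_span:
  "is_subfield {of_rat a + of_rat b * \<alpha> + of_rat c * \<alpha>\<^sup>2 | a b c. True}" (is "is_subfield ?V")
proof -
  have V: "x \<in> ?V \<longleftrightarrow> (\<exists>a b c. x = of_rat a + of_rat b * \<alpha> + of_rat c * \<alpha>\<^sup>2)" for x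
    by blast
  have VI: "of_rat a + of_rat b * \<alpha> + of_rat c * \<alpha>\<^sup>2 \<in> ?V" for a b c
    by blast
  have prod: "(of_rat a + of_rat b * \<alpha> + of_rat c * \<alpha>\<^sup>2) * (of_rat a' + of_rat b' * \<alpha> + of_rat c' * \<alpha>\<^sup>2) =
      of_rat (a * a' + of_nat m * (b * c' + c * b')) + of_rat (a * b' + b * a' + of_nat m * c * c') * \<alpha>
      + of_rat (a * c' + b * b' + c * a') * \<alpha>\<^sup>2" for a b c a' b' c'
  proof -
    \<comment> \<open>A polynomial identity in \<alpha>; the relation
      \<open>\<alpha> ^ 3 = m\<close> is isolated in the last summand, which then drops out.\<close>
    have "(of_rat a + of_rat b * \<alpha> + of_rat c * \<alpha>\<^sup>2) * (of_rat a' + of_rat b' * \<alpha> + of_rat c' * \<alpha>\<^sup>2) =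
      of_rat (a * a' + of_nat m * (b * c' + c * b')) + of_rat (a * b' + b * a' + of_nat m * c * c') * \<alpha>
      + of_rat (a * c' + b * b' + c * a') * \<alpha>\<^sup>2
      + (of_rat (b * c' + c * b') + of_rat (c * c') * \<alpha>) * (\<alpha> ^ 3 - real m)"
      by (simp add: of_rat_add of_rat_mult algebra_simps power2_eq_square power3_eq_cube)
    then show ?thesis by (simp add: cube)
  qed
  have inverse: "inverse x \<in> ?V" if "x \<in> ?V" for x
  proof -
    from that obtain a b c where x: "x = of_rat a + of_rat b * \<alpha> + of_rat c * \<alpha>\<^sup>2"
      unfolding V by blast
    \<comment> \<open>The norm form, and the product of the two other conjugates of \<open>x\<close>.\<close>
    define n where "n = a ^ 3 + of_nat m * b ^ 3 + (of_nat m)\<^sup>2 * c ^ 3 - 3 * of_nat m * a * b * c"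
    define a' b' c' where "a' = a\<^sup>2 - of_nat m * b * c" and "b' = of_nat m * c\<^sup>2 - a * b"
      and "c' = b\<^sup>2 - a * c"
    have "a * a' + of_nat m * (b * c' + c * b') = n" "a * b' + b * a' + of_nat m * c * c' = 0"
      "a * c' + b * b' + c * a' = 0"
      by (simp_all add: a'_def b'_def c'_def n_def algebra_simps power2_eq_square power3_eq_cube)
    then have n: "x * (of_rat a' + of_rat b' * \<alpha> + of_rat c' * \<alpha>\<^sup>2) = of_rat n"
      unfolding x prod by simp
    show ?thesis
    proof (cases "n = 0")
      case True
      have "x = 0"
      proof (rule ccontr)
        assume "x \<noteq> 0"
        \<comment> \<open>With norm 0 and \<open>x \<noteq> 0\<close>, the complementary factor is
          0. Independence makes its coordinates vanish, which again gives the equations of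
          \<open>cubes_proportional\<close>.\<close>
        with n True have "a' = 0 \<and> b' = 0 \<and> c' = 0"
          by (intro cube_root_independent) simp
        then have "b\<^sup>2 = a * c" "a * b = of_nat m * c\<^sup>2" "a\<^sup>2 = of_nat m * b * c"
          by (simp_all add: a'_def b'_def c'_def)
        with cubes_proportional[of b a c] have "a = 0" "b = 0" "c = 0" by auto
        with x \<open>x \<noteq> 0\<close> show False by simp
      qed
      with that show ?thesis by simp
    next
      case False
      then have "inverse x = of_rat (a' / n) + of_rat (b' / n) * \<alpha> + of_rat (c' / n) * \<alpha>\<^sup>2"
      proof -
        have "x * ((of_rat a' + of_rat b' * \<alpha> + of_rat c' * \<alpha>\<^sup>2) / of_rat n) = 1"
          using n False by simp
        then have "inverse x = (of_rat a' + of_rat b' * \<alpha> + of_rat c' * \<alpha>\<^sup>2) / of_rat n"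
          by (rule inverse_unique)
        then show ?thesis by (simp add: of_rat_divide add_divide_distrib)
      qed
      then show ?thesis by (simp only: VI)
    qed
  qed
  have one: "1 \<in> ?V"
    using VI[of 1 0 0] by simp
  have diff: "x - y \<in> ?V" if x: "x \<in> ?V" and y: "y \<in> ?V" for x y
  proof -
    obtain a b c a' b' c' where "x = of_rat a + of_rat b * \<alpha> + of_rat c * \<alpha>\<^sup>2"
      "y = of_rat a' + of_rat b' * \<alpha> + of_rat c' * \<alpha>\<^sup>2"
      using x y unfolding V by blast
    then have "x - y = of_rat (a - a') + of_rat (b - b') * \<alpha> + of_rat (c - c') * \<alpha>\<^sup>2"
      by (simp add: of_rat_diff algebra_simps)
    then show ?thesis by (simp only: VI)
  qed
  have mult: "x * y \<in> ?V" if x: "x \<in> ?V" and y: "y \<in> ?V" for x y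
  proof -
    obtain a b c a' b' c' where "x = of_rat a + of_rat b * \<alpha> + of_rat c * \<alpha>\<^sup>2"
      "y = of_rat a' + of_rat b' * \<alpha> + of_rat c' * \<alpha>\<^sup>2"
      using x y unfolding V by blast
    then show ?thesis by (simp only: prod VI)
  qed
  show ?thesis
    unfolding is_subfield_def using one diff mult inverse by blast
qed

text \<open>Purity describes only the range of \<open>\<phi>\<close>; the power basis found there is
  carried back along the injective map \<open>\<phi>\<close>.\<close>

lemma cubic_generator_cube_root:
  fixes \<phi> :: "'k::field_char_0 \<Rightarrow> real"
  assumes \<phi>: "field_hom \<phi>" "range \<phi> = generated_subfield {\<alpha>}"
  shows "\<exists>\<theta>. \<phi> \<theta> = \<alpha> \<and> cubic_generator \<theta> (of_nat m) 0 0"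
proof -
  have "\<alpha> \<in> range \<phi>"
    unfolding \<phi>(2) generated_subfield_def by blast
  then obtain \<theta> where \<theta>: "\<phi> \<theta> = \<alpha>" by auto
  note hom = field_hom_add[OF \<phi>(1)] field_hom_mult[OF \<phi>(1)] field_hom_power[OF \<phi>(1)]
    field_hom_of_rat[OF \<phi>(1)] field_hom_of_nat[OF \<phi>(1)]
  have \<phi>_eq: "\<phi> (of_rat a + of_rat b * \<theta> + of_rat c * \<theta>\<^sup>2) = of_rat a + of_rat b * \<alpha> + of_rat c * \<alpha>\<^sup>2" for a b c
    by (simp add: hom \<theta>)
  note inj = injD[OF field_hom_inj[OF \<phi>(1)]]
  have "cubic_generator \<theta> (of_nat m) 0 0"
  proof
    fix x
    have "\<alpha> = of_rat 0 + of_rat 1 * \<alpha> + of_rat 0 * \<alpha>\<^sup>2" by simp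
    then have "\<alpha> \<in> {of_rat a + of_rat b * \<alpha> + of_rat c * \<alpha>\<^sup>2 | a b c. True}" by blast
    then have "range \<phi> \<subseteq> {of_rat a + of_rat b * \<alpha> + of_rat c * \<alpha>\<^sup>2 | a b c. True}"
      unfolding \<phi>(2) generated_subfield_def using is_subfield_cube_root_span by blast
    then obtain a b c where "\<phi> x = of_rat a + of_rat b * \<alpha> + of_rat c * \<alpha>\<^sup>2"
      by blast
    then have "x = of_rat a + of_rat b * \<theta> + of_rat c * \<theta>\<^sup>2"
      unfolding \<phi>_eq[symmetric] by (rule inj)
    then show "\<exists>a b c. x = of_rat a + of_rat b * \<theta> + of_rat c * \<theta>\<^sup>2" by blast
  next
    fix a b c assume "of_rat a + of_rat b * \<theta> + of_rat c * \<theta>\<^sup>2 = 0"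
    then show "a = 0 \<and> b = 0 \<and> c = 0"
      using \<phi>_eq[of a b c] by (intro cube_root_independent) (simp add: field_hom_zero[OF \<phi>(1)])
  next
    show "\<theta> ^ 3 = of_rat (of_nat m) + of_rat 0 * \<theta> + of_rat 0 * \<theta>\<^sup>2"
      by (rule inj) (simp add: hom \<theta> cube)
  qed
  with \<theta> show ?thesis by blast
qed

end

section \<open>The Minkowski space of a pure cubic field\<close>

locale pure_cubic_generator = cubic_generator \<theta> "of_nat m" 0 0
  for \<theta> :: "'k::field_char_0" and m :: nat +
  fixes \<alpha> :: real
  assumes alpha_pos: "\<alpha> > 0" and alpha_cube: "\<alpha> ^ 3 = real m"
begin

abbreviation "e0 \<equiv> minkowski_embedding (1::'k)"
abbreviation "e1 \<equiv> minkowski_embedding \<theta>"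
abbreviation "e2 \<equiv> minkowski_embedding (\<theta>\<^sup>2)"

text \<open>The roots are \<alpha> times the three cube roots of unity, in rectangular coordinates
  so that sums over them reduce to real arithmetic.\<close>

lemma sum_cubic_roots:
  fixes g :: "complex \<Rightarrow> complex"
  shows "(\<Sum>z\<in>cubic_roots. g z) =
    g (of_real \<alpha>) + g (Complex (- \<alpha> / 2) (sqrt 3 / 2 * \<alpha>)) + g (Complex (- \<alpha> / 2) (- (sqrt 3 / 2 * \<alpha>)))"
proof -
  have \<alpha>: "\<alpha> \<in> cubic_roots"
    using alpha_cube by (simp add: cubic_roots_def)
  define s where "s = sqrt 3 / 2 * \<alpha>"
  have u: "(of_rat 0 - \<alpha>) / 2 = - \<alpha> / 2"
    by simp
  have d: "(- \<alpha> / 2)\<^sup>2 - (\<alpha>\<^sup>2 - of_rat 0 * \<alpha> - of_rat 0) = - (s\<^sup>2)"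
    by (simp add: s_def power_mult_distrib power_divide algebra_simps)
  have w: "csqrt (of_real (- (s\<^sup>2))) = \<i> * of_real s"
    using alpha_pos by (subst csqrt_of_real_nonpos) (simp_all add: s_def)
  have "cubic_roots = {complex_of_real \<alpha>, Complex (- \<alpha> / 2) s, Complex (- \<alpha> / 2) (- s)}"
    unfolding cubic_roots_real_root[OF \<alpha>] u d w by (simp add: Complex_eq)
  moreover have "s \<noteq> 0"
    using alpha_pos by (simp add: s_def)
  ultimately show ?thesis
    unfolding s_def[symmetric] by (simp add: complex_eq_iff add.assoc)
qed

text \<open>Orthogonality of the powers of \<theta> reflects the vanishing sum of the cube roots of
  unity; all conjugates of \<theta> have modulus \<alpha>, which gives the lengths.\<close>

lemma Gram_matrix:
  "minkowski_inner e0 e0 = 3" "minkowski_inner e1 e0 = 0" "minkowski_inner e2 e0 = 0"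
  "minkowski_inner e1 e1 = 3 * \<alpha>\<^sup>2" "minkowski_inner e2 e1 = 0" "minkowski_inner e2 e2 = 3 * \<alpha> ^ 4"
proof -
  have [simp]: "sqrt 3 * (sqrt 3 * t) = 3 * t" for t
    by (simp flip: mult.assoc)
  show "minkowski_inner e0 e0 = 3" "minkowski_inner e1 e0 = 0" "minkowski_inner e2 e0 = 0"
    "minkowski_inner e1 e1 = 3 * \<alpha>\<^sup>2" "minkowski_inner e2 e1 = 0" "minkowski_inner e2 e2 = 3 * \<alpha> ^ 4"
    unfolding minkowski_inner_embedding eval_at_one eval_at_theta eval_at_theta_sq sum_cubic_roots
    by (simp_all add: power2_eq_square power4_eq_xxxx field_simps)
qed

text \<open>Expanding field elements in the power basis shows that \<open>e0\<close>,
  \<open>e1\<close>, \<open>e2\<close> span the whole space. Orthogonality to \<open>e0\<close> then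
  removes its coefficient \<open>A\<close>.\<close>

lemma one_complement_eq:
  "one_complement = {\<lambda>\<sigma>. of_real b * e1 \<sigma> + of_real c * e2 \<sigma> | b c. True}"
proof (intro equalityI subsetI)
  fix v assume "v \<in> {\<lambda>\<sigma>. of_real b * e1 \<sigma> + of_real c * e2 \<sigma> | b c. True}"
  then show "v \<in> one_complement"
    by (auto simp: one_complement_def minkowski_space_combination minkowski_inner_add_left
        minkowski_inner_scale_left Gram_matrix)
next
  fix v assume v: "v \<in> (one_complement :: (('k \<Rightarrow> complex) \<Rightarrow> complex) set)"
  then obtain S w where v_eq: "v = (\<lambda>\<sigma>. \<Sum>x\<in>S. of_real (w x) * minkowski_embedding (x::'k) \<sigma>)"
    unfolding one_complement_def minkowski_space_def by auto
  obtain a b c where x: "x = of_rat (a x) + of_rat (b x) * \<theta> + of_rat (c x) * \<theta>\<^sup>2" for x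
    using spanning by metis
  have rat: "complex_of_real (of_rat e) = of_rat e" for e
    by (cases e) (simp add: of_rat_rat)
  have emb: "minkowski_embedding x \<sigma> = of_real (of_rat (a x)) * e0 \<sigma> + of_real (of_rat (b x)) * e1 \<sigma>
      + of_real (of_rat (c x)) * e2 \<sigma>" for x \<sigma>
  proof (cases "\<sigma> \<in> complex_embeddings")
    case True
    then have h: "field_hom \<sigma>" by (simp add: complex_embeddings_def)
    have "\<sigma> x = \<sigma> (of_rat (a x) + of_rat (b x) * \<theta> + of_rat (c x) * \<theta>\<^sup>2)"
      using x by simp
    with True show ?thesis
      by (simp add: minkowski_embedding_def field_hom_add[OF h] field_hom_mult[OF h]
          field_hom_of_rat[OF h] field_hom_one[OF h] rat)
  qed (simp add: minkowski_embedding_def)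
  define A B C where "A = (\<Sum>x\<in>S. w x * of_rat (a x))" and "B = (\<Sum>x\<in>S. w x * of_rat (b x))"
    and "C = (\<Sum>x\<in>S. w x * of_rat (c x))"
  have v': "v = (\<lambda>\<sigma>. of_real A * e0 \<sigma> + (of_real B * e1 \<sigma> + of_real C * e2 \<sigma>))"
    unfolding v_eq by (rule ext, subst emb)
      (simp add: A_def B_def C_def sum_distrib_left sum.distrib algebra_simps)
  have "minkowski_inner v e0 = 3 * A"
    unfolding v' by (simp add: minkowski_inner_add_left minkowski_inner_scale_left Gram_matrix)
  with v have "A = 0" by (simp add: one_complement_def)
  with v' show "v \<in> {\<lambda>\<sigma>. of_real b * e1 \<sigma> + of_real c * e2 \<sigma> | b c. True}"
    by auto
qed

text \<open>Ensures that the shape is not the empty set, so that equality of shapes carries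
  information. The map takes coordinates in the orthonormal basis obtained by normalizing
  \<open>e1\<close> and \<open>e2\<close>, hence the scale is 1.\<close>

lemma similitude_exists: "\<exists>f. similitude (f :: (('k \<Rightarrow> complex) \<Rightarrow> complex) \<Rightarrow> real ^ 2)"
proof -
  define f :: "(('k \<Rightarrow> complex) \<Rightarrow> complex) \<Rightarrow> real ^ 2" where
    "f v = (\<chi> i. if i = 1 then minkowski_inner v e1 / (sqrt 3 * \<alpha>) else minkowski_inner v e2 / (sqrt 3 * \<alpha>\<^sup>2))"
    for v
  define comb where "comb b c = (\<lambda>\<sigma>. of_real b * e1 \<sigma> + of_real c * e2 \<sigma>)" for b c
  have oc: "one_complement = {comb b c | b c. True}"
    unfolding one_complement_eq comb_def ..
  have e12: "minkowski_inner e1 e2 = 0"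
    using Gram_matrix(5) by (simp add: minkowski_inner_commute)
  have left: "minkowski_inner (comb b c) v = b * minkowski_inner e1 v + c * minkowski_inner e2 v" for b c v
    unfolding comb_def by (simp add: minkowski_inner_add_left minkowski_inner_scale_left)
  have inner1: "minkowski_inner (comb b c) e1 = b * (3 * \<alpha>\<^sup>2)" for b c
    by (simp add: left Gram_matrix)
  have inner2: "minkowski_inner (comb b c) e2 = c * (3 * \<alpha> ^ 4)" for b c
    by (simp add: left Gram_matrix e12)
  have inner: "minkowski_inner (comb b c) (comb b c) = 3 * \<alpha>\<^sup>2 * b\<^sup>2 + 3 * \<alpha> ^ 4 * c\<^sup>2" for b c
    unfolding left[of b c "comb b c"] minkowski_inner_commute[of e1 "comb b c"]
      minkowski_inner_commute[of e2 "comb b c"] inner1 inner2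
    by (simp add: power2_eq_square)
  have three: "3 / sqrt 3 = sqrt 3"
    by (rule real_div_sqrt) simp
  have div1: "b * (3 * \<alpha>\<^sup>2) / (sqrt 3 * \<alpha>) = sqrt 3 * \<alpha> * b" for b
  proof -
    have "b * (3 * \<alpha>\<^sup>2) / (sqrt 3 * \<alpha>) = (3 / sqrt 3) * \<alpha> * b"
      using alpha_pos by (simp add: power2_eq_square)
    then show ?thesis by (simp only: three)
  qed
  have div2: "c * (3 * \<alpha> ^ 4) / (sqrt 3 * \<alpha>\<^sup>2) = sqrt 3 * \<alpha>\<^sup>2 * c" for c
  proof -
    have "c * (3 * \<alpha> ^ 4) / (sqrt 3 * \<alpha>\<^sup>2) = (3 / sqrt 3) * \<alpha>\<^sup>2 * c"
      using alpha_pos by (simp add: power2_eq_square power4_eq_xxxx)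
    then show ?thesis by (simp only: three)
  qed
  have f: "f (comb b c) = (\<chi> i. if i = 1 then sqrt 3 * \<alpha> * b else sqrt 3 * \<alpha>\<^sup>2 * c)" for b c
    unfolding f_def inner1 inner2 div1 div2 ..
  have "similitude f"
    unfolding similitude_def
  proof (intro conjI)
    have "y \<in> f ` one_complement" for y
    proof -
      have "f (comb (y $ 1 / (sqrt 3 * \<alpha>)) (y $ 2 / (sqrt 3 * \<alpha>\<^sup>2))) = y"
        using alpha_pos by (simp add: f vec_eq_iff forall_2)
      then show ?thesis
        unfolding oc by (metis (mono_tags, lifting) image_eqI mem_Collect_eq)
    qed
    then show "f ` one_complement = UNIV" by auto
    show "\<forall>u\<in>one_complement. \<forall>v\<in>one_complement. f (\<lambda>\<sigma>. u \<sigma> + v \<sigma>) = f u + f v"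
      by (simp add: f_def vec_eq_iff minkowski_inner_add_left add_divide_distrib)
    show "\<forall>a::real. \<forall>v\<in>one_complement. f (\<lambda>\<sigma>. of_real a * v \<sigma>) = a *\<^sub>R f v"
      by (simp add: f_def vec_eq_iff minkowski_inner_scale_left)
    have "norm (f (comb b c)) = sqrt (minkowski_inner (comb b c) (comb b c))" for b c
      by (simp add: f inner norm_vec_def L2_set_def sum_2 power_mult_distrib)
    then have "\<forall>v\<in>one_complement. norm (f v) = 1 * sqrt (minkowski_inner v v)"
      unfolding oc by auto
    then show "\<exists>c>0. \<forall>v\<in>one_complement. norm (f v) = c * sqrt (minkowski_inner v v)"
      using zero_less_one by blast
  qed
  then show ?thesis by blast
qed

text \<open>Both \<theta> and \<open>\<theta>\<^sup>2\<close> are cube roots of natural numbers,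
  hence integral. Being orthogonal to 1 already, they are unchanged by the projection.\<close>

lemma generator_in_integers_perp: "e1 \<in> integers_perp" "e2 \<in> integers_perp"
proof -
  have cube: "\<theta> ^ 3 = of_nat m"
    using cube by simp
  have int: "algebraic_int x" if "x ^ 3 = of_nat n" for x :: 'k and n
    by (rule algebraic_int_root[of "of_nat n" "monom 1 3"])
       (auto simp: poly_monom degree_monom_eq that intro: int_imp_algebraic_int)
  have "(\<theta>\<^sup>2) ^ 3 = of_nat (m\<^sup>2)"
    by (simp add: cube power2_eq_square power_mult_distrib)
  with cube have "\<theta> \<in> ring_of_integers" "\<theta>\<^sup>2 \<in> ring_of_integers"
    unfolding ring_of_integers_def using int by blast+
  moreover have "proj_one_complement e1 = e1" "proj_one_complement e2 = e2"
    by (simp_all add: proj_one_complement_def Gram_matrix)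
  ultimately show "e1 \<in> integers_perp" "e2 \<in> integers_perp"
    unfolding integers_perp_def by (metis imageI)+
qed

end

section \<open>Comparison of the two lattices\<close>

lemma similitude_norm:
  assumes "similitude f"
  obtains c where "c > 0" "\<And>v. v \<in> one_complement \<Longrightarrow> (norm (f v))\<^sup>2 = c * minkowski_inner v v"
proof -
  obtain c where c: "c > 0" "\<And>v. v \<in> one_complement \<Longrightarrow> norm (f v) = c * sqrt (minkowski_inner v v)"
    using assms unfolding similitude_def by blast
  show ?thesis
    by (rule that[of "c\<^sup>2"]) (use c minkowski_inner_nonneg in \<open>simp_all add: power_mult_distrib\<close>)
qed

lemma shape_eq_imp_isomorphic:
  assumes pure: "pure_cubic_field TYPE('k::field_char_0)"
    and cubic: "cubic_field TYPE('l::field_char_0)"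
    and shape: "shape TYPE('l) = shape TYPE('k)"
  shows "isomorphic_fields TYPE('l) TYPE('k)"
proof -
  from pure obtain m and \<phi> :: "'k \<Rightarrow> real" where m: "m > 0" "\<nexists>n. n ^ 3 = m"
    and \<phi>: "field_hom \<phi>" "range \<phi> = generated_subfield {root 3 (real m)}"
    unfolding pure_cubic_field_def by blast
  define \<alpha> where "\<alpha> = root 3 (real m)"
  have \<alpha>: "\<alpha> > 0" "\<alpha> ^ 3 = real m"
    using m by (simp_all add: \<alpha>_def)
  have irrat: "\<alpha> \<notin> range of_rat"
    using cube_root_irrational[OF m(2)] by (simp add: \<alpha>_def Rats_def)
  note \<phi>' = \<phi>(2)[folded \<alpha>_def]
  obtain \<theta> :: 'k where "cubic_generator \<theta> (of_nat m) 0 0"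
    using cubic_generator_cube_root[OF \<alpha>(2) irrat \<phi>(1) \<phi>'] by blast
  then interpret K: pure_cubic_generator \<theta> m \<alpha>
    unfolding pure_cubic_generator_def pure_cubic_generator_axioms_def using \<alpha> by blast
  obtain \<eta> :: 'l and p q r where "cubic_generator \<eta> p q r"
    using cubic_field_irrational[OF cubic] cubic_field_generator[OF cubic] by blast
  then interpret L: cubic_generator \<eta> p q r .
  obtain \<rho> :: real where \<rho>: "\<rho> \<in> L.cubic_roots"
    using real_cubic_root_exists[of "of_rat p" "of_rat q" "of_rat r"] by (auto simp: L.cubic_roots_def)
  define \<sigma> where "\<sigma> = (L.eval_at \<rho> :: 'l \<Rightarrow> real)"
  have \<sigma>: "field_hom \<sigma>"
    unfolding \<sigma>_def by (rule L.field_hom_eval_at[OF \<rho>])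
  have F: "is_subfield (range \<sigma>)"
    by (rule is_subfield_range_field_hom[OF \<sigma>])
  obtain f :: "(('k \<Rightarrow> complex) \<Rightarrow> complex) \<Rightarrow> real ^ 2" where f: "similitude f"
    using K.similitude_exists by blast
  then have "f ` integers_perp \<in> shape TYPE('l)"
    unfolding shape by (auto simp: shape_def)
  then obtain g :: "(('l \<Rightarrow> complex) \<Rightarrow> complex) \<Rightarrow> real ^ 2"
    where g: "similitude g" "f ` integers_perp = g ` integers_perp"
    by (auto simp: shape_def)
  obtain cf where cf: "cf > 0" "\<And>v. v \<in> one_complement \<Longrightarrow> (norm (f v))\<^sup>2 = cf * minkowski_inner v v"
    using similitude_norm[OF f] by blast
  obtain cg where cg: "cg > 0" "\<And>v. v \<in> one_complement \<Longrightarrow> (norm (g v))\<^sup>2 = cg * minkowski_inner v v"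
    using similitude_norm[OF g(1)] by blast
  \<comment> \<open>The point \<open>f e\<close> is also the image under \<open>g\<close> of a
    projected integer of the other field. Its length measured there lies in the range of \<sigma>,
    up to the two scale factors.\<close>
  have length: "\<exists>t\<in>range \<sigma>. cf * minkowski_inner e e = cg * t"
    if e: "e \<in> integers_perp" "e \<in> one_complement" for e :: "('k \<Rightarrow> complex) \<Rightarrow> complex"
  proof -
    obtain x :: 'l where "f e = g (proj_one_complement (minkowski_embedding x))"
      using e(1) g(2) unfolding integers_perp_def by blast
    with cf(2)[OF e(2)] cg(2)[OF proj_one_complement_in]
    have "cf * minkowski_inner e e = cg * minkowski_inner
        (proj_one_complement (minkowski_embedding x)) (proj_one_complement (minkowski_embedding x))"
      using L.minkowski_inner_one_pos by (metis less_irrefl)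
    then show ?thesis
      using L.minkowski_inner_proj_in_real_field[OF \<rho>] unfolding \<sigma>_def by blast
  qed
  have "K.e1 \<in> one_complement" "K.e2 \<in> one_complement"
    using minkowski_space_combination[of 1 \<theta> 0 \<theta>] minkowski_space_combination[of 1 "\<theta>\<^sup>2" 0 \<theta>]
    by (simp_all add: one_complement_def K.Gram_matrix)
  with length K.generator_in_integers_perp obtain s t where st: "s \<in> range \<sigma>" "t \<in> range \<sigma>"
    "cf * (3 * \<alpha>\<^sup>2) = cg * s" "cf * (3 * \<alpha> ^ 4) = cg * t"
    by (metis K.Gram_matrix(4,6))
  \<comment> \<open>In the quotient of two lengths the unknown real scale factors \<open>cf\<close>
    and \<open>cg\<close> disappear.\<close>
  have "\<alpha>\<^sup>2 = (cf * (3 * \<alpha> ^ 4)) / (cf * (3 * \<alpha>\<^sup>2))"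
    using cf(1) \<alpha>(1) by (simp add: power2_eq_square power4_eq_xxxx)
  also have "\<dots> = t / s"
    unfolding st(3,4) using cg(1) by simp
  finally have "\<alpha>\<^sup>2 \<in> range \<sigma>"
    using is_subfieldD(6)[OF F st(2,1)] by simp
  moreover have "\<alpha> = real m / \<alpha>\<^sup>2"
    unfolding \<alpha>(2)[symmetric] using \<alpha>(1) by (simp add: power2_eq_square power3_eq_cube)
  moreover have "real m \<in> range \<sigma>"
    by (metis field_hom_of_nat[OF \<sigma>] rangeI)
  ultimately have \<alpha>_F: "\<alpha> \<in> range \<sigma>"
    using is_subfieldD(6)[OF F] by metis
  then obtain \<theta>' where \<theta>': "\<sigma> \<theta>' = \<alpha>" by blast
  \<comment> \<open>Irrationality makes \<theta>' a generator of the second field, so that the range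
    of \<sigma> is spanned by the powers of \<alpha>; this gives the inclusion of the range of
    \<sigma> in that of \<open>\<phi>\<close>.\<close>
  have "\<theta>' \<notin> range of_rat"
    using \<theta>' irrat field_hom_of_rat[OF \<sigma>] by (metis imageE rangeI)
  then obtain p' q' r' where "cubic_generator \<theta>' p' q' r'"
    using cubic_field_generator[OF cubic] by blast
  then interpret L': cubic_generator \<theta>' p' q' r' .
  have "range \<sigma> = range \<phi>"
  proof
    show "range \<phi> \<subseteq> range \<sigma>"
      unfolding \<phi>' generated_subfield_def using F \<alpha>_F by blast
    have \<phi>_F: "is_subfield (range \<phi>)"
      by (rule is_subfield_range_field_hom[OF \<phi>(1)])
    have \<alpha>_\<phi>: "\<alpha> \<in> range \<phi>"
      unfolding \<phi>' generated_subfield_def by blast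
    show "range \<sigma> \<subseteq> range \<phi>"
    proof
      fix y assume "y \<in> range \<sigma>"
      then obtain a b c where "y = \<sigma> (of_rat a + of_rat b * \<theta>' + of_rat c * \<theta>'\<^sup>2)"
        using L'.spanning by (metis rangeE)
      then have "y = of_rat a + of_rat b * \<alpha> + of_rat c * \<alpha>\<^sup>2"
        by (simp add: \<theta>' field_hom_add[OF \<sigma>] field_hom_mult[OF \<sigma>] field_hom_power[OF \<sigma>] field_hom_of_rat[OF \<sigma>])
      then show "y \<in> range \<phi>"
        by (simp only:) (intro is_subfieldD[OF \<phi>_F] of_rat_in_subfield[OF \<phi>_F] \<alpha>_\<phi>)
    qed
  qed
  then show ?thesis
    by (rule isomorphic_fieldsI_range[OF \<phi>(1) \<sigma>])
qed

theorem theoremB: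
  assumes "pure_cubic_field TYPE('k::field_char_0)"
    and "cubic_field TYPE('l::field_char_0)"
  shows "(shape TYPE('l) = shape TYPE('k) \<longrightarrow> isomorphic_fields TYPE('l) TYPE('k)) \<and>
    (isomorphic_fields TYPE('l) TYPE('k) \<longrightarrow> shape TYPE('l) = shape TYPE('k)) \<and>
    (pure_cubic_field TYPE('l) \<and> \<not> isomorphic_fields TYPE('l) TYPE('k) \<longrightarrow>
       shape TYPE('l) \<noteq> shape TYPE('k)) \<and>
    (\<not> pure_cubic_field TYPE('l) \<longrightarrow> shape TYPE('l) \<noteq> shape TYPE('k))"
  using shape_eq_imp_isomorphic[OF assms] isomorphic_fields_imp_shape_eq
    isomorphic_fields_pure[OF _ assms(1)] by blast

end
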